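(* The following hold. (1) For each $n\in\mathbb{Z}$, $\overline{c}_r(n)$ is multiplicative as a function of $r\in\mathbb{N}$. (2) For each $r\in\mathbb{N}$, $\overline{c}_r(n)$ is semimultiplicative as a function of $n\in\mathbb{N}$. (3) $\overline{c}_r(n)$ is multiplicative as a function of the two variables $r,n\in\mathbb{N}$.
   Context: $\mathbb{N}$ is the set of positive integers. An integer $a$ is regular (mod $r$) if there is an integer $x$ with $a^2x\equiv a \pmod r$. Define $$\overline{c}_r(n)=\sum_{\substack{a \pmod r\\ a\text{ regular}\pmod r}}\exp(2\pi i a n/r),$$ the sum being over the regular elements $a$ of a complete residue system mod $r$ (e.g. $1\le a\le r$). A function $f:\mathbb{N}\to\mathbb{C}$ is multiplicative if $f(1)=1$ and $f(mn)=f(m)f(n)$ whenever $\gcd(m,n)=1$. It is semimultiplicative if $f(m)f(n)=f(\gcd(m,n))f(\operatorname{lcm}(m,n))$ for all $m,n\in\mathbb{N}$. A function $F:\mathbb{N}^2\to\mathbb{C}$ is multiplicative as a function of two variables if $F(1,1)=1$ and $F(n_1,n_2)F(m_1,m_2)=F(n_1m_1,n_2m_2)$ for all $n_1,n_2,m_1,m_2\in\mathbb{N}$ with $\gcd(n_1n_2,m_1m_2)=1$. *)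

theory Defs
  imports Complex_Main "HOL-Number_Theory.Cong"
begin

definition regular_mod :: "nat \<Rightarrow> int \<Rightarrow> bool" where
  "regular_mod r a \<longleftrightarrow> (\<exists>x::int. [a\<^sup>2 * x = a] (mod int r))"

(* For r > 0 the complete residue system is taken to be 1, ..., r. Both regularity and the
   summand depend only on the residue class of a modulo r. *)
definition regular_ramanujan_sum :: "nat \<Rightarrow> int \<Rightarrow> complex" where
  "regular_ramanujan_sum r n =
     (\<Sum>a \<in> {a \<in> {1..int r}. regular_mod r a}.
        exp (2 * complex_of_real pi * \<i> * of_int a * of_int n / of_nat r))"

(* Arithmetical functions have the positive integers as domain, so the values at 0 of
   functions on nat are left unconstrained in the following three definitions. *)

definition multiplicative_arith :: "(nat \<Rightarrow> complex) \<Rightarrow> bool" where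
  "multiplicative_arith f \<longleftrightarrow>
     f 1 = 1 \<and> (\<forall>m>0. \<forall>n>0. coprime m n \<longrightarrow> f (m * n) = f m * f n)"

definition semimultiplicative_arith :: "(nat \<Rightarrow> complex) \<Rightarrow> bool" where
  "semimultiplicative_arith f \<longleftrightarrow>
     (\<forall>m>0. \<forall>n>0. f m * f n = f (gcd m n) * f (lcm m n))"

definition multiplicative_arith2 :: "(nat \<Rightarrow> nat \<Rightarrow> complex) \<Rightarrow> bool" where
  "multiplicative_arith2 F \<longleftrightarrow>
     F 1 1 = 1 \<and>
     (\<forall>n1>0. \<forall>n2>0. \<forall>m1>0. \<forall>m2>0.
        coprime (n1 * n2) (m1 * m2) \<longrightarrow> F n1 n2 * F m1 m2 = F (n1 * m1) (n2 * m2))"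

end

theory Submission
  imports Defs
begin

text \<open>
  By the Chinese remainder theorem the sum splits over coprime moduli. Multiplying \<open>n\<close> by a
  unit modulo \<open>r\<close> only permutes the regular residues, so for a prime power modulus \<open>p ^ k\<close> the sum
  depends only on the \<open>p\<close>-part of \<open>n\<close>. Since the \<open>p\<close>-parts of \<open>gcd m n\<close> and \<open>lcm m n\<close> are those of
  \<open>m\<close> and \<open>n\<close> in some order, semimultiplicativity is immediate for prime powers, and it
  is inherited by pointwise products.
\<close>

section \<open>Regular residues: coprime moduli and multiplication by units\<close>

lemma regular_mod_cong:
  assumes "[a = b] (mod int r)"
  shows "regular_mod r a \<longleftrightarrow> regular_mod r b"
proof -
  have "[a\<^sup>2 * x = b\<^sup>2 * x] (mod int r)" for x
    using assms by (intro cong_mult cong_pow cong_refl)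
  with assms show ?thesis
    unfolding regular_mod_def by (meson cong_sym cong_trans)
qed

lemma regular_mod_mod [simp]: "regular_mod r (a mod int r) \<longleftrightarrow> regular_mod r a"
  by (rule regular_mod_cong) simp

text \<open>A witness modulo the product serves modulo each factor. Conversely, the Chinese
  remainder theorem glues the witnesses \<open>x\<close> and \<open>y\<close> into one
  \<open>z\<close> that works modulo both factors, hence modulo their product.\<close>

lemma regular_mod_mult:
  assumes "coprime r s"
  shows "regular_mod (r * s) a \<longleftrightarrow> regular_mod r a \<and> regular_mod s a"
proof
  assume "regular_mod (r * s) a"
  then show "regular_mod r a \<and> regular_mod s a"
    unfolding regular_mod_def
    by (metis cong_modulus_mult mult.commute of_nat_mult)
next
  assume "regular_mod r a \<and> regular_mod s a"
  then obtain x y where x: "[a\<^sup>2 * x = a] (mod int r)" and y: "[a\<^sup>2 * y = a] (mod int s)"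
    unfolding regular_mod_def by blast
  have cop: "coprime (int r) (int s)" using assms by simp
  then obtain z where zx: "[z = x] (mod int r)" and zy: "[z = y] (mod int s)"
    using binary_chinese_remainder_int by blast
  have "[a\<^sup>2 * z = a] (mod int r)"
    using cong_trans[OF cong_scalar_left[OF zx] x] .
  moreover have "[a\<^sup>2 * z = a] (mod int s)"
    using cong_trans[OF cong_scalar_left[OF zy] y] .
  ultimately have "[a\<^sup>2 * z = a] (mod int r * int s)"
    using cop by (rule coprime_cong_mult)
  then show "regular_mod (r * s) a"
    unfolding regular_mod_def by auto
qed

text \<open>A witness for \<open>a\<close> times an inverse \<open>w\<close> of \<open>u\<close> is
  a witness for \<open>a * u\<close>. The converse is the same implication with the roles of
  \<open>u\<close> and \<open>w\<close> exchanged, since \<open>a * u * w\<close> lies in the class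
  of \<open>a\<close>.\<close>

lemma regular_mod_mult_unit:
  assumes "coprime u (int r)"
  shows "regular_mod r (a * u) \<longleftrightarrow> regular_mod r a"
proof -
  have unit: "regular_mod r (b * v)" if "regular_mod r b" "[v * w = 1] (mod int r)" for b v w
  proof -
    obtain x where x: "[b\<^sup>2 * x = b] (mod int r)"
      using \<open>regular_mod r b\<close> unfolding regular_mod_def by blast
    have "[(b\<^sup>2 * x) * v * (v * w) = b * v * 1] (mod int r)"
      by (intro cong_mult x that cong_refl)
    also have "(b\<^sup>2 * x) * v * (v * w) = (b * v)\<^sup>2 * (x * w)"
      by (simp add: power2_eq_square)
    finally show ?thesis unfolding regular_mod_def by auto
  qed
  obtain w where w: "[u * w = 1] (mod int r)"
    using assms cong_solve_coprime_int by blast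
  have "[a * u * w = a * 1] (mod int r)"
    unfolding mult.assoc by (intro cong_mult w cong_refl)
  then have "regular_mod r (a * u * w) \<longleftrightarrow> regular_mod r a"
    by (intro regular_mod_cong) simp
  then show ?thesis
    using unit[of "a * u" w u] unit[of a u w] w by (auto simp: mult.commute)
qed

section \<open>The additive character modulo \<open>r\<close> and the sum over residue
  classes\<close>

definition additive_char :: "nat \<Rightarrow> int \<Rightarrow> complex" where
  "additive_char r x = exp (2 * complex_of_real pi * \<i> * of_int x / of_nat r)"

lemma additive_char_add: "additive_char r (x + y) = additive_char r x * additive_char r y"
  by (simp add: additive_char_def exp_add [symmetric] add_divide_distrib distrib_left)

lemma additive_char_mult_cancel:
  assumes "s > 0"
  shows "additive_char (r * s) (int s * x) = additive_char r x"
  using assms by (simp add: additive_char_def mult_ac)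

lemma additive_char_cong:
  assumes "r > 0" "[x = y] (mod int r)"
  shows "additive_char r x = additive_char r y"
proof -
  obtain k where k: "y = x + k * int r"
    using assms(2) by (metis cong_iff_lin mult.commute)
  have "additive_char r (k * int r) = cis (2 * pi * of_int k)"
    using assms(1) by (simp add: additive_char_def cis_conv_exp mult_ac)
  also have "\<dots> = 1"
    by (rule cis_multiple_2pi) simp
  finally show ?thesis by (simp add: k additive_char_add)
qed

text \<open>The range \<open>{0..<int r}\<close> consists of the values of \<open>mod int r\<close>,
  so later reindexings by maps reduced modulo \<open>r\<close> stay inside the index set.\<close>

lemma regular_ramanujan_sum_altdef:
  assumes "r > 0"
  shows "regular_ramanujan_sum r n =
           (\<Sum>a | a \<in> {0..<int r} \<and> regular_mod r a. additive_char r (a * n))"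
proof -
  have "(\<Sum>a | a \<in> {1..int r} \<and> regular_mod r a. additive_char r (a * n)) =
        (\<Sum>a | a \<in> {0..<int r} \<and> regular_mod r a. additive_char r (a * n))"
  proof (rule sum.reindex_bij_witness)
    fix a assume a: "a \<in> {a. a \<in> {1..int r} \<and> regular_mod r a}"
    \<comment> \<open>The two ranges differ only in the representative of the zero class: reduction
      sends \<open>r\<close> to 0, the inverse map sends 0 back to \<open>r\<close>, and all other
      elements stay fixed.\<close>
    show "a mod int r \<in> {a. a \<in> {0..<int r} \<and> regular_mod r a}"
      using a assms by simp
    show "(if a mod int r = 0 then int r else a mod int r) = a"
      using a by (cases "a = int r") auto
    show "additive_char r (a mod int r * n) = additive_char r (a * n)"
      using assms by (intro additive_char_cong cong_mult) simp_all
  next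
    fix a assume a: "a \<in> {a. a \<in> {0..<int r} \<and> regular_mod r a}"
    show "(if a = 0 then int r else a) mod int r = a"
      using a by auto
    then have "regular_mod r (if a = 0 then int r else a)"
      using a by (metis (no_types, lifting) mem_Collect_eq regular_mod_mod)
    then show "(if a = 0 then int r else a) \<in> {a. a \<in> {1..int r} \<and> regular_mod r a}"
      using a assms by auto
  qed
  then show ?thesis
    by (simp add: regular_ramanujan_sum_def additive_char_def mult.assoc)
qed

lemma regular_ramanujan_sum_1 [simp]: "regular_ramanujan_sum (Suc 0) n = 1"
proof -
  have "{a. a \<in> {0..<1::int} \<and> regular_mod 1 a} = {0}"
    by (auto simp: regular_mod_def)
  then show ?thesis
    using regular_ramanujan_sum_altdef[of 1 n] by (simp add: additive_char_def)
qed

text \<open>Cancelling the unit gives injectivity, and an injective self-map of a finite set is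
  onto.\<close>

lemma bij_betw_mult_mod:
  assumes "r > 0" "coprime u (int r)"
  shows "bij_betw (\<lambda>a. a * u mod int r) {0..<int r} {0..<int r}"
proof -
  have "inj_on (\<lambda>a. a * u mod int r) {0..<int r}"
  proof (rule inj_onI)
    fix a b assume ab: "a \<in> {0..<int r}" "b \<in> {0..<int r}" "a * u mod int r = b * u mod int r"
    then have "[a = b] (mod int r)"
      using assms(2) cong_mult_rcancel unfolding cong_def by blast
    then show "a = b" using ab by (simp add: cong_def)
  qed
  moreover have "(\<lambda>a. a * u mod int r) ` {0..<int r} \<subseteq> {0..<int r}"
    using assms(1) by auto
  ultimately show ?thesis
    by (simp add: bij_betw_def endo_inj_surj)
qed

lemma regular_ramanujan_sum_mult_unit:
  assumes "r > 0" "coprime u (int r)"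
  shows "regular_ramanujan_sum r (n * u) = regular_ramanujan_sum r n"
proof -
  let ?R = "{a. a \<in> {0..<int r} \<and> regular_mod r a}"
  let ?h = "\<lambda>a. a * u mod int r"
  have "bij_betw ?h {a \<in> {0..<int r}. regular_mod r a} {a \<in> {0..<int r}. regular_mod r a}"
    using bij_betw_mult_mod[OF assms]
    by (rule bij_betw_Collect) (simp add: regular_mod_mult_unit assms)
  then have "(\<Sum>a\<in>?R. additive_char r (?h a * n)) = (\<Sum>a\<in>?R. additive_char r (a * n))"
    by (rule sum.reindex_bij_betw)
  \<comment> \<open>Here the unit passes from the summation index to the argument
    \<open>n\<close>.\<close>
  moreover have "additive_char r (?h a * n) = additive_char r (a * (n * u))" for a
  proof (rule additive_char_cong[OF assms(1)])
    have "[?h a * n = a * u * n] (mod int r)"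
      by (intro cong_mult) simp_all
    then show "[?h a * n = a * (n * u)] (mod int r)" by (simp add: mult_ac)
  qed
  ultimately show ?thesis
    by (simp add: regular_ramanujan_sum_altdef assms)
qed

section \<open>Splitting the sum over coprime moduli\<close>

lemma bij_betw_crt:
  assumes "r > 0" "s > 0" "coprime r s"
  shows "bij_betw (\<lambda>(b, c). (b * int s + c * int r) mod int (r * s))
           ({0..<int r} \<times> {0..<int s}) {0..<int (r * s)}"
    (is "bij_betw ?h ?A ?B")
proof -
  \<comment> \<open>Modulo \<open>r\<close> the term \<open>c * int r\<close> vanishes and the unit
    \<open>s\<close> cancels. The moduli are generalised so that the fact also yields
    \<open>c = c'\<close> with \<open>r\<close> and \<open>s\<close> exchanged.\<close>
  have eq1: "b = b'"
    if "r > 0" "coprime r s" "b \<in> {0..<int r}" "b' \<in> {0..<int r}"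
      "[b * int s + c * int r = b' * int s + c' * int r] (mod int r)" for r s b b' c c'
  proof -
    have "[b * int s = b' * int s] (mod int r)"
      using that(5) by (simp add: cong_def)
    moreover have "coprime (int s) (int r)"
      using that(2) by (simp add: coprime_commute)
    ultimately have "[b = b'] (mod int r)"
      using cong_mult_rcancel by blast
    then show ?thesis using that by (simp add: cong_def)
  qed
  have "inj_on ?h ?A"
  proof (rule inj_onI, clarify)
    fix b c b' c'
    assume bc: "b \<in> {0..<int r}" "b' \<in> {0..<int r}" "c \<in> {0..<int s}" "c' \<in> {0..<int s}"
      and "(b * int s + c * int r) mod int (r * s) = (b' * int s + c' * int r) mod int (r * s)"
    then have *: "[b * int s + c * int r = b' * int s + c' * int r] (mod (int r * int s))"
      by (simp add: cong_def)
    show "b = b' \<and> c = c'"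
    proof
      show "b = b'"
        using eq1[OF assms(1,3) bc(1,2) cong_modulus_mult[OF *]] .
      have "[c * int r + b * int s = c' * int r + b' * int s] (mod (int s * int r))"
        using * by (simp add: add.commute mult.commute)
      then show "c = c'"
        using eq1[of s r c c' b b'] assms bc cong_modulus_mult
        by (simp add: coprime_commute) blast
    qed
  qed
  moreover have "?h ` ?A \<subseteq> ?B"
    using assms by auto
  moreover have "card ?A = card ?B"
    by (simp add: card_cartesian_product nat_mult_distrib)
  ultimately show ?thesis
    by (simp add: bij_betw_def card_image card_subset_eq)
qed

lemma regular_ramanujan_sum_mult:
  assumes "r > 0" "s > 0" "coprime r s"
  shows "regular_ramanujan_sum (r * s) n = regular_ramanujan_sum r n * regular_ramanujan_sum s n"
proof -
  let ?R = "\<lambda>r. {a. a \<in> {0..<int r} \<and> regular_mod r a}"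
  let ?h = "\<lambda>(b, c). (b * int s + c * int r) mod int (r * s)"
  \<comment> \<open>The index is \<open>b * int s\<close> modulo \<open>r\<close> and
    \<open>c * int r\<close> modulo \<open>s\<close>, each a unit multiple of its
    coordinate.\<close>
  have "regular_mod (r * s) (?h (b, c)) \<longleftrightarrow> regular_mod r b \<and> regular_mod s c" for b c
  proof -
    have "regular_mod (r * s) (?h (b, c)) \<longleftrightarrow>
            regular_mod r (b * int s + c * int r) \<and> regular_mod s (b * int s + c * int r)"
      unfolding prod.case regular_mod_mod regular_mod_mult[OF assms(3)] ..
    also have "regular_mod r (b * int s + c * int r) \<longleftrightarrow> regular_mod r (b * int s)"
      by (rule regular_mod_cong) (simp add: cong_def)
    also have "\<dots> \<longleftrightarrow> regular_mod r b"
      using assms by (intro regular_mod_mult_unit) (simp add: coprime_commute)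
    also have "regular_mod s (b * int s + c * int r) \<longleftrightarrow> regular_mod s (c * int r)"
      by (rule regular_mod_cong) (simp add: cong_def)
    also have "\<dots> \<longleftrightarrow> regular_mod s c"
      using assms by (intro regular_mod_mult_unit) simp
    finally show ?thesis .
  qed
  then have "bij_betw ?h
      {x \<in> {0..<int r} \<times> {0..<int s}. regular_mod r (fst x) \<and> regular_mod s (snd x)}
      {a \<in> {0..<int (r * s)}. regular_mod (r * s) a}"
    by (intro bij_betw_Collect[OF bij_betw_crt[OF assms]]) auto
  moreover have "{x \<in> {0..<int r} \<times> {0..<int s}. regular_mod r (fst x) \<and> regular_mod s (snd x)}
      = ?R r \<times> ?R s" by auto
  ultimately have bij: "bij_betw ?h (?R r \<times> ?R s) (?R (r * s))" by simp
  \<comment> \<open>This is the reason for the parametrisation \<open>b * int s + c * int r\<close>: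
    divided by \<open>r * s\<close> it becomes b/r + c/s, so the character factors with the same
    \<open>n\<close> on both sides and no modular inverses appear.\<close>
  have char: "additive_char (r * s) (?h x * n) =
      additive_char r (fst x * n) * additive_char s (snd x * n)" for x
  proof -
    obtain b c where x: "x = (b, c)" by force
    have "[?h x * n = (b * int s + c * int r) * n] (mod int (r * s))"
      unfolding x prod.case by (intro cong_mult) simp_all
    then have "additive_char (r * s) (?h x * n) =
        additive_char (r * s) (int s * (b * n) + int r * (c * n))"
      using assms by (intro additive_char_cong) (simp_all add: algebra_simps)
    also have "\<dots> = additive_char r (b * n) * additive_char s (c * n)"
      using additive_char_mult_cancel[of s r "b * n"] additive_char_mult_cancel[of r s "c * n"] assms
      by (simp add: additive_char_add mult.commute)
    finally show ?thesis by (simp add: x)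
  qed
  have "regular_ramanujan_sum (r * s) n = (\<Sum>a\<in>?R (r * s). additive_char (r * s) (a * n))"
    using assms by (intro regular_ramanujan_sum_altdef) simp
  also have "\<dots> = (\<Sum>x\<in>?R r \<times> ?R s. additive_char (r * s) (?h x * n))"
    by (rule sum.reindex_bij_betw[OF bij, symmetric])
  also have "\<dots> = (\<Sum>(b, c)\<in>?R r \<times> ?R s. additive_char r (b * n) * additive_char s (c * n))"
    unfolding char by (simp add: case_prod_unfold)
  also have "\<dots> = regular_ramanujan_sum r n * regular_ramanujan_sum s n"
    using assms by (simp add: regular_ramanujan_sum_altdef sum_product sum.cartesian_product)
  finally show ?thesis .
qed

section \<open>Semimultiplicativity, from prime powers to all moduli\<close>

lemma regular_ramanujan_sum_prime_power:
  assumes "prime p" "m > 0" "n > 0" "multiplicity p m = multiplicity p n"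
  shows "regular_ramanujan_sum (p ^ k) (int m) = regular_ramanujan_sum (p ^ k) (int n)"
proof -
  \<comment> \<open>Both arguments are compared with their \<open>p\<close>-part: the cofactor
    \<open>u\<close> is prime to \<open>p\<close>, hence a unit modulo \<open>p ^ k\<close>.\<close>
  have "regular_ramanujan_sum (p ^ k) (int a) =
          regular_ramanujan_sum (p ^ k) (int (p ^ multiplicity p a))" if "a > 0" for a
  proof -
    obtain u where u: "a = p ^ multiplicity p a * u" "\<not> p dvd u"
      using multiplicity_decompose'[of a p] \<open>a > 0\<close> \<open>prime p\<close> not_prime_unit by blast
    then have "coprime u (p ^ k)"
      using \<open>prime p\<close> by (simp add: prime_imp_coprime coprime_commute)
    then have "coprime (int u) (int (p ^ k))"
      by (simp only: coprime_int_iff)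
    then have "regular_ramanujan_sum (p ^ k) (int (p ^ multiplicity p a) * int u) =
        regular_ramanujan_sum (p ^ k) (int (p ^ multiplicity p a))"
      using \<open>prime p\<close> by (intro regular_ramanujan_sum_mult_unit) (simp_all add: prime_gt_0_nat)
    then show ?thesis using u(1) by (metis of_nat_mult)
  qed
  then show ?thesis using assms by metis
qed

lemma semimultiplicative_regular_ramanujan_sum_prime_power:
  assumes "prime p"
  shows "semimultiplicative_arith (\<lambda>n. regular_ramanujan_sum (p ^ k) (int n))"
  unfolding semimultiplicative_arith_def
proof (intro allI impI)
  fix m n :: nat assume mn: "m > 0" "n > 0"
  let ?f = "\<lambda>n. regular_ramanujan_sum (p ^ k) (int n)"
  \<comment> \<open>The exponent of \<open>p\<close> in \<open>gcd m n\<close> is the minimum and in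
    \<open>lcm m n\<close> the maximum of the two exponents; the opposite order is covered by
    exchanging \<open>m\<close> and \<open>n\<close>.\<close>
  have *: "?f (gcd m n) = ?f m \<and> ?f (lcm m n) = ?f n"
    if "m > 0" "n > 0" "multiplicity p m \<le> multiplicity p n" for m n
    using that assms
    by (auto intro!: regular_ramanujan_sum_prime_power
             simp: multiplicity_gcd multiplicity_lcm lcm_pos_nat)
  show "?f m * ?f n = ?f (gcd m n) * ?f (lcm m n)"
    using *[of m n] *[of n m] mn
    by (cases "multiplicity p m \<le> multiplicity p n") (simp_all add: gcd.commute lcm.commute)
qed

lemma semimultiplicative_arith_mult:
  assumes "semimultiplicative_arith f" "semimultiplicative_arith g"
  shows "semimultiplicative_arith (\<lambda>n. f n * g n)"
  unfolding semimultiplicative_arith_def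
proof (intro allI impI)
  fix m n :: nat assume "m > 0" "n > 0"
  then have "f m * f n = f (gcd m n) * f (lcm m n)" "g m * g n = g (gcd m n) * g (lcm m n)"
    using assms by (simp_all add: semimultiplicative_arith_def)
  then have "(f m * f n) * (g m * g n) =
      (f (gcd m n) * f (lcm m n)) * (g (gcd m n) * g (lcm m n))" by simp
  then show "f m * g m * (f n * g n) =
      f (gcd m n) * g (gcd m n) * (f (lcm m n) * g (lcm m n))"
    by (simp only: mult_ac)
qed

text \<open>Strong induction on \<open>r\<close>: the full power of one prime divisor is split off,
  and the induction hypothesis handles the coprime cofactor.\<close>

lemma semimultiplicative_regular_ramanujan_sum:
  assumes "r > 0"
  shows "semimultiplicative_arith (\<lambda>n. regular_ramanujan_sum r (int n))"
  using assms
proof (induction r rule: less_induct)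
  case (less r)
  show ?case
  proof (cases "r = 1")
    case True
    then show ?thesis by (simp add: semimultiplicative_arith_def)
  next
    case False
    then obtain p where p: "prime p" "p dvd r"
      using prime_factor_nat by blast
    obtain s where s: "r = p ^ multiplicity p r * s" "\<not> p dvd s"
      using multiplicity_decompose'[of r p] p less.prems not_prime_unit by blast
    define k where "k = multiplicity p r"
    have r: "r = p ^ k * s" and k: "k > 0"
      using s(1) p less.prems by (simp_all add: k_def prime_multiplicity_gt_zero_iff)
    have "s > 0" using r less.prems by (cases s) auto
    \<comment> \<open>Since \<open>p\<close> divides \<open>r\<close>, the exponent is positive and
      the cofactor \<open>s\<close> is strictly smaller than \<open>r\<close>.\<close>
    moreover have "p ^ k > 1" using p k by (metis one_less_power prime_gt_1_nat)
    ultimately have "s < r" unfolding r by simp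
    have cop: "coprime (p ^ k) s"
      using p s(2) by (simp add: prime_imp_coprime)
    have "semimultiplicative_arith
        (\<lambda>n. regular_ramanujan_sum (p ^ k) (int n) * regular_ramanujan_sum s (int n))"
      using \<open>s < r\<close> \<open>s > 0\<close> p(1)
      by (intro semimultiplicative_arith_mult less.IH
            semimultiplicative_regular_ramanujan_sum_prime_power)
    then show ?thesis
      using regular_ramanujan_sum_mult[OF _ \<open>s > 0\<close> cop] p(1) by (simp add: r prime_gt_0_nat)
  qed
qed

section \<open>Multiplicativity in both variables\<close>

lemma multiplicative_arith2_regular_ramanujan_sum:
  "multiplicative_arith2 (\<lambda>r n. regular_ramanujan_sum r (int n))"
  unfolding multiplicative_arith2_def
proof (intro conjI allI impI)
  show "regular_ramanujan_sum 1 (int 1) = 1" by simp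
next
  fix n1 n2 m1 m2 :: nat
  assume pos: "n1 > 0" "n2 > 0" "m1 > 0" "m2 > 0" and cop: "coprime (n1 * n2) (m1 * m2)"
  \<comment> \<open>The modulus splits because \<open>n1\<close> and \<open>m1\<close> are coprime.
    Moreover \<open>m2\<close> is a unit modulo \<open>n1\<close> and \<open>n2\<close> a unit
    modulo \<open>m1\<close>, so each sum can drop the foreign factor, which is written on the right
    for this purpose.\<close>
  have "regular_ramanujan_sum (n1 * m1) (int (n2 * m2)) =
      regular_ramanujan_sum n1 (int n2 * int m2) * regular_ramanujan_sum m1 (int m2 * int n2)"
    using pos cop by (simp add: regular_ramanujan_sum_mult mult.commute[of "int m2"])
  also have "regular_ramanujan_sum n1 (int n2 * int m2) = regular_ramanujan_sum n1 (int n2)"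
    using pos cop by (intro regular_ramanujan_sum_mult_unit) (simp_all add: coprime_commute)
  also have "regular_ramanujan_sum m1 (int m2 * int n2) = regular_ramanujan_sum m1 (int m2)"
    using pos cop by (intro regular_ramanujan_sum_mult_unit) simp_all
  finally show "regular_ramanujan_sum n1 (int n2) * regular_ramanujan_sum m1 (int m2) =
      regular_ramanujan_sum (n1 * m1) (int (n2 * m2))" ..
qed

theorem theorem5p2:
  shows "(\<forall>n::int. multiplicative_arith (\<lambda>r. regular_ramanujan_sum r n)) \<and>
         (\<forall>r::nat. r > 0 \<longrightarrow> semimultiplicative_arith (\<lambda>n. regular_ramanujan_sum r (int n))) \<and>
         multiplicative_arith2 (\<lambda>r n. regular_ramanujan_sum r (int n))"
  by (simp add: multiplicative_arith_def regular_ramanujan_sum_mult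
        semimultiplicative_regular_ramanujan_sum multiplicative_arith2_regular_ramanujan_sum)

end
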